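(* Let $(X,\mathcal B)$ be a standard Borel space, $(T_n)_{n\in\mathbb N}$ a sequence in $Aut(X,\mathcal B)$ and $S\in Aut(X,\mathcal B)$. Then $$(T_n\xrightarrow{\,p\,}S)\ \Longrightarrow\ (T_n\xrightarrow{\,\tau\,}S)\ \Longleftrightarrow\ (T_n\xrightarrow{\,\tau''\,}S)\ \Longleftrightarrow\ (T_n\xrightarrow{\,\overline p\,}S).$$
   Context: $Aut(X,\mathcal B)$ is the group of all one-to-one Borel automorphisms of $X$; $\mathcal M_1(X)$ is the set of Borel probability measures on $X$; $B(X)_1$ is the set of Borel functions $f:X\to\mathbb R$ with $\sup|f|\le1$. For $S,T\in Aut(X,\mathcal B)$, $E(S,T)=\{x: Tx\ne Sx\}\cup\{x: T^{-1}x\ne S^{-1}x\}$, and $\mu\circ S(f)=\int_X f(S^{-1}x)\,d\mu(x)$. The topologies on $Aut(X,\mathcal B)$ are given by the following bases of neighborhoods ($T\in Aut(X,\mathcal B)$, $\mu_j\in\mathcal M_1(X)$, $F_i\in\mathcal B$, $\varepsilon>0$, finite families): $\tau$: $\{S:\mu_j(E(S,T))<\varepsilon,\ j=1,\dots,n\}$; $\tau''$: $\{S:\sup_{f\in B(X)_1}|\mu_j\circ S(f)-\mu_j\circ T(f)|<\varepsilon,\ j=1,\dots,n\}$; $p$: $\{S: SF_i=TF_i,\ i=1,\dots,k\}$; $\overline p$: $\{S:\mu_j(SF_i\,\Delta\, TF_i)+\mu_j(S^{-1}F_i\,\Delta\, T^{-1}F_i)<\varepsilon,\ i=1,\dots,k,\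 j=1,\dots,n\}$. *)

theory Defs
  imports "HOL-Probability.Probability"
begin

text \<open>A measurable space is represented by a value \<open>M :: 'a measure\<close> of which only \<open>space M\<close>
  and \<open>sets M\<close> matter; its measure component is never used.\<close>

definition standard_borel_space :: "'a measure \<Rightarrow> bool" where
  "standard_borel_space M \<longleftrightarrow>
    (\<exists>X. completely_metrizable_space X \<and> second_countable X \<and>
         topspace X = space M \<and> sets M = sigma_sets (space M) {U. openin X U})"

text \<open>Automorphisms are normalised to be \<open>undefined\<close> outside the space, so that equality of
  automorphisms is equality of HOL functions.\<close>

definition borel_aut :: "'a measure \<Rightarrow> ('a \<Rightarrow> 'a) set" where
  "borel_aut M = {T \<in> extensional (space M).
     bij_betw T (space M) (space M) \<and> T \<in> M \<rightarrow>\<^sub>M M \<and> inv_into (space M) T \<in> M \<rightarrow>\<^sub>M M}"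

definition borel_probs :: "'a measure \<Rightarrow> 'a measure set" where
  "borel_probs M = {\<mu>. prob_space \<mu> \<and> sets \<mu> = sets M}"

definition borel_unit_ball :: "'a measure \<Rightarrow> ('a \<Rightarrow> real) set" where
  "borel_unit_ball M = {f \<in> borel_measurable M. \<forall>x\<in>space M. \<bar>f x\<bar> \<le> 1}"

definition diff_set :: "'a measure \<Rightarrow> ('a \<Rightarrow> 'a) \<Rightarrow> ('a \<Rightarrow> 'a) \<Rightarrow> 'a set" where
  "diff_set M S T = {x \<in> space M. T x \<noteq> S x} \<union>
     {x \<in> space M. inv_into (space M) T x \<noteq> inv_into (space M) S x}"

definition comp_functional :: "'a measure \<Rightarrow> 'a measure \<Rightarrow> ('a \<Rightarrow> 'a) \<Rightarrow> ('a \<Rightarrow> real) \<Rightarrow> real" where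
  "comp_functional M \<mu> S f = (\<integral>x. f (inv_into (space M) S x) \<partial>\<mu>)"

definition tau_nbhd :: "'a measure \<Rightarrow> ('a \<Rightarrow> 'a) \<Rightarrow> 'a measure set \<Rightarrow> real \<Rightarrow> ('a \<Rightarrow> 'a) set" where
  "tau_nbhd M T P \<epsilon> = {S \<in> borel_aut M. \<forall>\<mu>\<in>P. measure \<mu> (diff_set M S T) < \<epsilon>}"

definition tau''_nbhd :: "'a measure \<Rightarrow> ('a \<Rightarrow> 'a) \<Rightarrow> 'a measure set \<Rightarrow> real \<Rightarrow> ('a \<Rightarrow> 'a) set" where
  "tau''_nbhd M T P \<epsilon> = {S \<in> borel_aut M. \<forall>\<mu>\<in>P.
     (SUP f\<in>borel_unit_ball M. \<bar>comp_functional M \<mu> S f - comp_functional M \<mu> T f\<bar>) < \<epsilon>}"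

definition p_nbhd :: "'a measure \<Rightarrow> ('a \<Rightarrow> 'a) \<Rightarrow> 'a set set \<Rightarrow> ('a \<Rightarrow> 'a) set" where
  "p_nbhd M T \<F> = {S \<in> borel_aut M. \<forall>F\<in>\<F>. S ` F = T ` F}"

definition pbar_nbhd ::
  "'a measure \<Rightarrow> ('a \<Rightarrow> 'a) \<Rightarrow> 'a set set \<Rightarrow> 'a measure set \<Rightarrow> real \<Rightarrow> ('a \<Rightarrow> 'a) set" where
  "pbar_nbhd M T \<F> P \<epsilon> = {S \<in> borel_aut M. \<forall>F\<in>\<F>. \<forall>\<mu>\<in>P.
     measure \<mu> (sym_diff (S ` F) (T ` F)) +
     measure \<mu> (sym_diff (inv_into (space M) S ` F) (inv_into (space M) T ` F)) < \<epsilon>}"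

text \<open>The neighbourhoods of \<open>T\<close> are the finite intersections of balls around \<open>T\<close> for a family of
  pseudometrics (for \<open>p\<close>: of classes of a family of equivalence relations). Hence, over all \<open>T\<close>, they
  form a base of the topology they generate, and those at \<open>T\<close> form a base of neighbourhoods of \<open>T\<close>.
  Empty finite families are allowed; they only contribute the whole group.\<close>

definition tau_topology :: "'a measure \<Rightarrow> ('a \<Rightarrow> 'a) topology" where
  "tau_topology M = topology_generated_by
     {tau_nbhd M T P \<epsilon> | T P \<epsilon>. T \<in> borel_aut M \<and> finite P \<and> P \<subseteq> borel_probs M \<and> \<epsilon> > 0}"

definition tau''_topology :: "'a measure \<Rightarrow> ('a \<Rightarrow> 'a) topology" where
  "tau''_topology M = topology_generated_by
     {tau''_nbhd M T P \<epsilon> | T P \<epsilon>. T \<in> borel_aut M \<and> finite P \<and> P \<subseteq> borel_probs M \<and> \<epsilon> > 0}"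

definition p_topology :: "'a measure \<Rightarrow> ('a \<Rightarrow> 'a) topology" where
  "p_topology M = topology_generated_by
     {p_nbhd M T \<F> | T \<F>. T \<in> borel_aut M \<and> finite \<F> \<and> \<F> \<subseteq> sets M}"

definition pbar_topology :: "'a measure \<Rightarrow> ('a \<Rightarrow> 'a) topology" where
  "pbar_topology M = topology_generated_by
     {pbar_nbhd M T \<F> P \<epsilon> | T \<F> P \<epsilon>. T \<in> borel_aut M \<and> finite \<F> \<and> \<F> \<subseteq> sets M \<and>
        finite P \<and> P \<subseteq> borel_probs M \<and> \<epsilon> > 0}"

end

theory Submission
  imports Defs
begin

text \<open>Each of \<open>\<tau>\<close>-, \<open>\<tau>''\<close>- and p-bar-convergence of a sequence is equivalent to a pointwise condition:
  for every \<open>x\<close>, \<open>T\<^sub>n x = S x\<close> for all large \<open>n\<close>. Testing against Dirac measures (and singletons, or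
  their indicators) gives the condition. Conversely the condition passes to inverses, because
  \<open>T\<^sub>n (S\<^sup>-\<^sup>1 y) = y\<close> means \<open>T\<^sub>n\<^sup>-\<^sup>1 y = S\<^sup>-\<^sup>1 y\<close>; hence \<open>\<mu> (E (S, T\<^sub>n)) \<rightarrow> 0\<close> by continuity from above, and
  this quantity dominates the three families of pseudometrics. \<open>p\<close>-convergence gives the pointwise
  condition by taking \<open>F = {x}\<close>.\<close>

section \<open>Limits in a topology given by a subbase\<close>

text \<open>The sets that eventually contain \<open>f n\<close> as soon as they contain
  \<open>l\<close> are closed under finite intersections and arbitrary unions, so it suffices to
  test the generators. Membership of \<open>l\<close> in the union of \<open>\<G>\<close> says that
  \<open>l\<close> lies in the underlying space.\<close>

lemma limitin_topology_generated_by: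
  "limitin (topology_generated_by \<G>) f l F \<longleftrightarrow>
     l \<in> \<Union>\<G> \<and> (\<forall>U\<in>\<G>. l \<in> U \<longrightarrow> (\<forall>\<^sub>F n in F. f n \<in> U))"
    (is "?lhs \<longleftrightarrow> ?rhs")
proof
  assume ?lhs
  then show ?rhs
    by (auto simp: limitin_def topology_generated_by_topspace topology_generated_by_Basis)
next
  assume rhs: ?rhs
  have "\<forall>\<^sub>F n in F. f n \<in> U" if "generate_topology_on \<G> U" "l \<in> U" for U
    using that
  proof (induction rule: generate_topology_on.induct)
    case (Int a b)
    then show ?case by (auto intro: eventually_conj)
  next
    case (UN K)
    then obtain k where "k \<in> K" "l \<in> k" "\<forall>\<^sub>F n in F. f n \<in> k" by blast
    then show ?case by (auto elim: eventually_mono)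
  qed (use rhs in auto)
  with rhs show ?lhs
    by (auto simp: limitin_def topology_generated_by_topspace openin_topology_generated_by_iff)
qed

section \<open>Measurable disagreement sets and singletons\<close>

text \<open>A countable base of the topology does this, since a metrizable space is
  Hausdorff.\<close>

lemma standard_borel_space_countable_separating:
  assumes "standard_borel_space M"
  obtains \<B> where "countable \<B>" "\<B> \<subseteq> sets M"
    "\<And>x y. \<lbrakk>x \<in> space M; y \<in> space M; x \<noteq> y\<rbrakk> \<Longrightarrow> \<exists>U\<in>\<B>. x \<in> U \<and> y \<notin> U"
proof -
  obtain X where X: "completely_metrizable_space X" "second_countable X" "topspace X = space M"
    and M: "sets M = sigma_sets (space M) {U. openin X U}"
    using assms unfolding standard_borel_space_def by blast
  obtain \<B> where \<B>: "countable \<B>" "\<And>V. V \<in> \<B> \<Longrightarrow> openin X V"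
    "\<And>U x. openin X U \<Longrightarrow> x \<in> U \<Longrightarrow> \<exists>V\<in>\<B>. x \<in> V \<and> V \<subseteq> U"
    using X(2) unfolding second_countable_def by metis
  have "Hausdorff_space X"
    using X(1) completely_metrizable_imp_metrizable_space metrizable_imp_Hausdorff_space by blast
  show thesis
  proof
    show "\<B> \<subseteq> sets M" using \<B>(2) by (auto simp: M)
    fix x y assume "x \<in> space M" "y \<in> space M" "x \<noteq> y"
    then obtain U V where "openin X U" "x \<in> U" "y \<in> V" "disjnt U V"
      using \<open>Hausdorff_space X\<close> X(3) unfolding Hausdorff_space_def by metis
    moreover from this obtain W where "W \<in> \<B>" "x \<in> W" "W \<subseteq> U" using \<B>(3) by blast
    ultimately show "\<exists>U\<in>\<B>. x \<in> U \<and> y \<notin> U" by (auto simp: disjnt_iff)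
  qed fact
qed

text \<open>Two values differ exactly when some member of a countable separating family contains the
  first but not the second. This writes the set as a countable union of differences of
  preimages.\<close>

lemma standard_borel_space_disagreement_set:
  assumes "standard_borel_space M" and [measurable]: "f \<in> N \<rightarrow>\<^sub>M M" "g \<in> N \<rightarrow>\<^sub>M M"
  shows "{x \<in> space N. f x \<noteq> g x} \<in> sets N"
proof -
  obtain \<B> where \<B>: "countable \<B>" "\<B> \<subseteq> sets M"
    "\<And>x y. \<lbrakk>x \<in> space M; y \<in> space M; x \<noteq> y\<rbrakk> \<Longrightarrow> \<exists>U\<in>\<B>. x \<in> U \<and> y \<notin> U"
    using standard_borel_space_countable_separating[OF assms(1)] by blast
  have "{x \<in> space N. f x \<noteq> g x} = (\<Union>U\<in>\<B>. (f -` U \<inter> space N) - (g -` U \<inter> space N))"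
    using \<B>(3) measurable_space[OF assms(2)] measurable_space[OF assms(3)] by (fastforce dest: spec)
  also have "\<dots> \<in> sets N"
    using \<B>(1,2) measurable_sets[OF assms(2)] measurable_sets[OF assms(3)]
    by (intro sets.countable_UN') blast+
  finally show ?thesis .
qed

text \<open>The complement is the set where the identity and the constant map \<open>x\<close>
  disagree.\<close>

lemma standard_borel_space_singleton:
  assumes "standard_borel_space M" "x \<in> space M"
  shows "{x} \<in> sets M"
proof -
  have "space M - {y \<in> space M. y \<noteq> x} \<in> sets M"
    using standard_borel_space_disagreement_set[OF assms(1), of "\<lambda>y. y" M "\<lambda>_. x"] assms(2) by auto
  also have "space M - {y \<in> space M. y \<noteq> x} = {x}"
    using assms(2) by auto
  finally show ?thesis .
qed

section \<open>Automorphisms, their inverses and images of sets\<close>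

lemma borel_autD:
  assumes "T \<in> borel_aut M"
  shows borel_aut_measurable: "T \<in> M \<rightarrow>\<^sub>M M"
    and borel_aut_inv_measurable: "inv_into (space M) T \<in> M \<rightarrow>\<^sub>M M"
    and borel_aut_space: "x \<in> space M \<Longrightarrow> T x \<in> space M"
    and borel_aut_inv_space: "x \<in> space M \<Longrightarrow> inv_into (space M) T x \<in> space M"
    and borel_aut_inv_left: "x \<in> space M \<Longrightarrow> inv_into (space M) T (T x) = x"
    and borel_aut_inv_right: "x \<in> space M \<Longrightarrow> T (inv_into (space M) T x) = x"
proof -
  have bij: "bij_betw T (space M) (space M)"
    and *: "T \<in> M \<rightarrow>\<^sub>M M" "inv_into (space M) T \<in> M \<rightarrow>\<^sub>M M"
    using assms by (auto simp: borel_aut_def)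
  show "T \<in> M \<rightarrow>\<^sub>M M" "inv_into (space M) T \<in> M \<rightarrow>\<^sub>M M" by fact+
  show "x \<in> space M \<Longrightarrow> T x \<in> space M" "x \<in> space M \<Longrightarrow> inv_into (space M) T x \<in> space M"
    using *[THEN measurable_space] by auto
  show "x \<in> space M \<Longrightarrow> inv_into (space M) T (T x) = x"
    "x \<in> space M \<Longrightarrow> T (inv_into (space M) T x) = x"
    using bij by (auto intro: bij_betw_inv_into_left bij_betw_inv_into_right)
qed

text \<open>Images become preimages under the inverse map: these are measurable, and membership of a
  point in them depends only on the value of that map there.\<close>

lemma borel_aut_image:
  assumes "T \<in> borel_aut M" "F \<subseteq> space M"
  shows "T ` F = inv_into (space M) T -` F \<inter> space M"
    and "inv_into (space M) T ` F = T -` F \<inter> space M"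
proof -
  note aut = borel_autD(3-6)[OF assms(1)]
  show "T ` F = inv_into (space M) T -` F \<inter> space M"
  proof (intro set_eqI iffI)
    fix y assume "y \<in> inv_into (space M) T -` F \<inter> space M"
    then have "inv_into (space M) T y \<in> F" "y = T (inv_into (space M) T y)" using aut by auto
    then show "y \<in> T ` F" by blast
  qed (use aut assms(2) in auto)
  show "inv_into (space M) T ` F = T -` F \<inter> space M"
  proof (intro set_eqI iffI)
    fix x assume "x \<in> T -` F \<inter> space M"
    then have "T x \<in> F" "x = inv_into (space M) T (T x)" using aut by auto
    then show "x \<in> inv_into (space M) T ` F" by blast
  qed (use aut assms(2) in auto)
qed

lemma borel_aut_image_sets:
  assumes "T \<in> borel_aut M" "F \<in> sets M"
  shows "T ` F \<in> sets M" "inv_into (space M) T ` F \<in> sets M"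
  using borel_autD(1,2)[OF assms(1), THEN measurable_sets, OF assms(2)]
  by (simp_all add: borel_aut_image[OF assms(1) sets.sets_into_space[OF assms(2)]])

lemma diff_set_sets:
  assumes "standard_borel_space M" "S \<in> borel_aut M" "T \<in> borel_aut M"
  shows "diff_set M S T \<in> sets M"
  unfolding diff_set_def
  by (intro sets.Un standard_borel_space_disagreement_set[OF assms(1)]
      borel_autD(1,2)[OF assms(2)] borel_autD(1,2)[OF assms(3)])

text \<open>Each direction uses the hypothesis at one other point, \<open>S x\<close> or the
  \<open>S\<close>-preimage of \<open>x\<close>. Thresholds may therefore depend on the
  point.\<close>

lemma borel_aut_eventually_inv_eq:
  assumes "\<And>n. T n \<in> borel_aut M" "S \<in> borel_aut M"
  shows "(\<forall>x\<in>space M. \<forall>\<^sub>F n in F. inv_into (space M) (T n) x = inv_into (space M) S x) \<longleftrightarrow>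
    (\<forall>x\<in>space M. \<forall>\<^sub>F n in F. T n x = S x)"
proof (intro iffI ballI)
  fix x
  assume *: "\<forall>x\<in>space M. \<forall>\<^sub>F n in F. inv_into (space M) (T n) x = inv_into (space M) S x"
    and x: "x \<in> space M"
  have "\<forall>\<^sub>F n in F. inv_into (space M) (T n) (S x) = inv_into (space M) S (S x)"
    using * x borel_autD[OF assms(2)] by blast
  then show "\<forall>\<^sub>F n in F. T n x = S x"
    by eventually_elim (metis assms borel_aut_inv_left borel_aut_inv_right borel_aut_space x)
next
  fix x
  assume *: "\<forall>x\<in>space M. \<forall>\<^sub>F n in F. T n x = S x" and x: "x \<in> space M"
  have "\<forall>\<^sub>F n in F. T n (inv_into (space M) S x) = S (inv_into (space M) S x)"
    using * x borel_autD[OF assms(2)] by blast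
  then show "\<forall>\<^sub>F n in F. inv_into (space M) (T n) x = inv_into (space M) S x"
    by eventually_elim (metis assms borel_aut_inv_left borel_aut_inv_right borel_aut_inv_space x)
qed

section \<open>Vanishing measure of the disagreement sets\<close>

text \<open>The tail unions of the \<open>A k\<close> decrease to their upper limit, which is empty
  because every point leaves the sequence for good. Continuity from above applies to these unions,
  and they dominate the sets \<open>A n\<close>.\<close>

lemma (in finite_measure) measure_tendsto_0_if_eventually_notin:
  assumes "\<And>n. A n \<in> sets M" "\<And>x. x \<in> space M \<Longrightarrow> \<forall>\<^sub>F n in sequentially. x \<notin> A n"
  shows "(\<lambda>n. measure M (A n)) \<longlonglongrightarrow> 0"
proof -
  let ?B = "\<lambda>n. \<Union>k\<in>{n..}. A k"
  have B: "?B n \<in> sets M" for n using assms(1) by auto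
  have "decseq ?B" by (rule antimonoI) fastforce
  then have "(\<lambda>n. measure M (?B n)) \<longlonglongrightarrow> measure M (\<Inter>n. ?B n)"
    using B by (intro finite_Lim_measure_decseq) auto
  moreover have "(\<Inter>n. ?B n) = {}"
  proof (intro equals0I)
    fix x assume x: "x \<in> (\<Inter>n. ?B n)"
    then have "x \<in> space M" using B sets.sets_into_space by blast
    then obtain N where "\<forall>n\<ge>N. x \<notin> A n"
      using assms(2) by (auto simp: eventually_sequentially)
    with x show False by auto
  qed
  ultimately have "(\<lambda>n. measure M (?B n)) \<longlonglongrightarrow> 0" by simp
  then show ?thesis
    by (rule tendsto_sandwich[OF _ _ tendsto_const, rotated 2])
      (use B in \<open>auto intro!: always_eventually finite_measure_mono\<close>)
qed

text \<open>At a fixed point both clauses of \<open>diff_set\<close> fail for large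
  \<open>n\<close>: the first by assumption, the second because pointwise agreement passes to
  inverses.\<close>

lemma measure_diff_set_tendsto_0:
  assumes "standard_borel_space M" "\<And>n. T n \<in> borel_aut M" "S \<in> borel_aut M"
    and "\<mu> \<in> borel_probs M" and pw: "\<forall>x\<in>space M. \<forall>\<^sub>F n in sequentially. T n x = S x"
  shows "(\<lambda>n. measure \<mu> (diff_set M (T n) S)) \<longlonglongrightarrow> 0"
proof -
  interpret prob_space \<mu> using assms(4) by (simp add: borel_probs_def)
  have sets: "sets \<mu> = sets M" and space: "space \<mu> = space M"
    using assms(4) by (auto simp: borel_probs_def dest: sets_eq_imp_space_eq)
  show ?thesis
  proof (rule measure_tendsto_0_if_eventually_notin)
    fix x assume "x \<in> space \<mu>"
    then have "\<forall>\<^sub>F n in sequentially. T n x = S x"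
      "\<forall>\<^sub>F n in sequentially. inv_into (space M) (T n) x = inv_into (space M) S x"
      using pw borel_aut_eventually_inv_eq[of T M S, OF assms(2,3)] by (auto simp: space)
    then show "\<forall>\<^sub>F n in sequentially. x \<notin> diff_set M (T n) S"
      by eventually_elim (auto simp: diff_set_def)
  qed (use diff_set_sets[OF assms(1-3)] sets in auto)
qed

section \<open>Bounds by the measure of the disagreement set\<close>

text \<open>The difference of the integrands vanishes where the inverses agree, hence off
  \<open>diff_set M T S\<close>, and is at most 2 in absolute value elsewhere. The bound is uniform
  in \<open>f\<close>, as the supremum in \<open>tau''_nbhd\<close> requires.\<close>

lemma abs_comp_functional_diff_le:
  assumes "standard_borel_space M" "T \<in> borel_aut M" "S \<in> borel_aut M"
    and "\<mu> \<in> borel_probs M" and f: "f \<in> borel_unit_ball M"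
  shows "\<bar>comp_functional M \<mu> T f - comp_functional M \<mu> S f\<bar> \<le> 2 * measure \<mu> (diff_set M T S)"
proof -
  interpret prob_space \<mu> using assms(4) by (simp add: borel_probs_def)
  have sets: "sets \<mu> = sets M" and space: "space \<mu> = space M"
    using assms(4) by (auto simp: borel_probs_def dest: sets_eq_imp_space_eq)
  have int: "integrable \<mu> (\<lambda>x. f (inv_into (space M) R x))" if R: "R \<in> borel_aut M" for R
  proof (rule integrable_const_bound[where B=1])
    show "AE x in \<mu>. norm (f (inv_into (space M) R x)) \<le> 1"
      using f borel_autD[OF R] by (intro AE_I2) (auto simp: space borel_unit_ball_def)
    have "(\<lambda>x. f (inv_into (space M) R x)) \<in> borel_measurable M"
      using measurable_compose[OF borel_aut_inv_measurable[OF R], of f borel] f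
      by (simp add: borel_unit_ball_def)
    then show "(\<lambda>x. f (inv_into (space M) R x)) \<in> borel_measurable \<mu>"
      by (simp add: measurable_cong_sets[OF sets refl])
  qed
  have D: "diff_set M T S \<in> sets \<mu>" using diff_set_sets[OF assms(1-3)] sets by simp
  let ?g = "\<lambda>x. f (inv_into (space M) T x) - f (inv_into (space M) S x)"
  have "\<bar>comp_functional M \<mu> T f - comp_functional M \<mu> S f\<bar> = \<bar>\<integral>x. ?g x \<partial>\<mu>\<bar>"
    unfolding comp_functional_def using int assms(2,3) by simp
  also have "\<dots> \<le> (\<integral>x. \<bar>?g x\<bar> \<partial>\<mu>)" by (rule integral_abs_bound)
  also have "\<dots> \<le> (\<integral>x. 2 * indicator (diff_set M T S) x \<partial>\<mu>)"
  proof (rule integral_mono)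
    show "integrable \<mu> (\<lambda>x. \<bar>?g x\<bar>)"
      using int assms(2,3) by (intro integrable_abs Bochner_Integration.integrable_diff)
    show "integrable \<mu> (\<lambda>x. 2 * indicator (diff_set M T S) x :: real)"
      using D by (intro integrable_mult_right integrable_real_indicator) (auto simp: emeasure_eq_measure)
    fix x assume x: "x \<in> space \<mu>"
    then have "\<bar>f (inv_into (space M) T x)\<bar> \<le> 1" "\<bar>f (inv_into (space M) S x)\<bar> \<le> 1"
      using f borel_autD[OF assms(2)] borel_autD[OF assms(3)] by (auto simp: space borel_unit_ball_def)
    then show "\<bar>?g x\<bar> \<le> 2 * indicator (diff_set M T S) x"
      using x by (auto simp: diff_set_def space indicator_def)
  qed
  also have "\<dots> = 2 * measure \<mu> (diff_set M T S)"
    using D by simp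
  finally show ?thesis .
qed

text \<open>With images read as preimages, a point where the inverses agree is in both forward
  images or in neither. Agreement of the maps themselves does the same for the inverse
  images.\<close>

lemma sym_diff_image_subset_diff_set:
  assumes "T \<in> borel_aut M" "S \<in> borel_aut M" "F \<subseteq> space M"
  shows "sym_diff (T ` F) (S ` F) \<subseteq> diff_set M T S"
    and "sym_diff (inv_into (space M) T ` F) (inv_into (space M) S ` F) \<subseteq> diff_set M T S"
  by (auto simp: borel_aut_image[OF _ assms(3)] assms(1,2) diff_set_def)

section \<open>Pointwise description of the three topologies\<close>

text \<open>Dirac measures are the test measures below: they give a measurable set mass 0 or 1, so a
  mass below 1 means that the point is outside the set.\<close>

lemma dirac_in_borel_probs: "x \<in> space M \<Longrightarrow> return M x \<in> borel_probs M"
  by (simp add: borel_probs_def prob_space_return)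

lemma limitin_tau_iff_pointwise:
  assumes "standard_borel_space M" "\<And>n. T n \<in> borel_aut M" "S \<in> borel_aut M"
  shows "limitin (tau_topology M) T S sequentially \<longleftrightarrow>
    (\<forall>x\<in>space M. \<forall>\<^sub>F n in sequentially. T n x = S x)" (is "_ \<longleftrightarrow> ?pw")
proof
  assume lim: "limitin (tau_topology M) T S sequentially"
  show ?pw
  proof
    fix x assume x: "x \<in> space M"
    have "tau_nbhd M S {return M x} 1 \<in> {tau_nbhd M T P \<epsilon> | T P \<epsilon>.
        T \<in> borel_aut M \<and> finite P \<and> P \<subseteq> borel_probs M \<and> \<epsilon> > 0}"
      using x assms(3) dirac_in_borel_probs
      by (intro CollectI exI[of _ S] exI[of _ "{return M x}"] exI[of _ 1]) auto
    moreover have "S \<in> tau_nbhd M S {return M x} 1"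
      using assms(3) by (simp add: tau_nbhd_def diff_set_def)
    ultimately have "\<forall>\<^sub>F n in sequentially. T n \<in> tau_nbhd M S {return M x} 1"
      using lim unfolding tau_topology_def limitin_topology_generated_by by meson
    then show "\<forall>\<^sub>F n in sequentially. T n x = S x"
    proof eventually_elim
      case (elim n)
      have "x \<notin> diff_set M (T n) S"
        using elim diff_set_sets[OF assms] by (auto simp: tau_nbhd_def measure_return)
      with x show ?case by (auto simp: diff_set_def)
    qed
  qed
next
  assume pw: ?pw
  show "limitin (tau_topology M) T S sequentially"
    unfolding tau_topology_def limitin_topology_generated_by
  proof (intro conjI ballI impI)
    \<comment> \<open>The empty family of measures gives the whole group, which puts
      \<open>S\<close> in the underlying space of the topology.\<close>
    have "S \<in> tau_nbhd M S {} 1" using assms(3) by (simp add: tau_nbhd_def)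
    then show "S \<in> \<Union>{tau_nbhd M T P \<epsilon> | T P \<epsilon>.
        T \<in> borel_aut M \<and> finite P \<and> P \<subseteq> borel_probs M \<and> \<epsilon> > 0}"
      using assms(3) by (intro UnionI[of "tau_nbhd M S {} 1"] CollectI exI[of _ S]
        exI[of _ "{}"] exI[of _ 1]) auto
    fix U assume "U \<in> {tau_nbhd M T P \<epsilon> | T P \<epsilon>.
        T \<in> borel_aut M \<and> finite P \<and> P \<subseteq> borel_probs M \<and> \<epsilon> > 0}" and SU: "S \<in> U"
    then obtain R P \<epsilon> where U: "U = tau_nbhd M R P \<epsilon>"
      and R: "R \<in> borel_aut M" and P: "finite P" "P \<subseteq> borel_probs M" by blast
    have "\<forall>\<^sub>F n in sequentially. measure \<mu> (diff_set M (T n) R) < \<epsilon>" if \<mu>: "\<mu> \<in> P" for \<mu>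
    proof -
      have \<mu>': "\<mu> \<in> borel_probs M" using P \<mu> by blast
      interpret prob_space \<mu> using \<mu>' by (simp add: borel_probs_def)
      have sets: "sets \<mu> = sets M" using \<mu>' by (simp add: borel_probs_def)
      \<comment> \<open>The generator is centred at some \<open>R\<close>, possibly different from
        \<open>S\<close>. Strict inequality at \<open>S\<close> leaves room for \<open>T n\<close>
        to deviate from \<open>S\<close>, by the triangle inequality for the measure of
        disagreement.\<close>
      have "measure \<mu> (diff_set M S R) < \<epsilon>" using SU U \<mu> by (simp add: tau_nbhd_def)
      then have "\<forall>\<^sub>F n in sequentially.
          measure \<mu> (diff_set M (T n) S) < \<epsilon> - measure \<mu> (diff_set M S R)"
        by (intro order_tendstoD[OF measure_diff_set_tendsto_0] assms \<mu>' pw) simp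
      then show ?thesis
      proof eventually_elim
        case (elim n)
        have D: "diff_set M (T n) S \<in> sets \<mu>" "diff_set M S R \<in> sets \<mu>"
          using diff_set_sets assms R sets by auto
        have "measure \<mu> (diff_set M (T n) R) \<le> measure \<mu> (diff_set M (T n) S \<union> diff_set M S R)"
          using D by (intro finite_measure_mono) (auto simp: diff_set_def)
        also have "\<dots> \<le> measure \<mu> (diff_set M (T n) S) + measure \<mu> (diff_set M S R)"
          using D by (intro measure_Un_le)
        finally show ?case using elim by simp
      qed
    qed
    then show "\<forall>\<^sub>F n in sequentially. T n \<in> U"
      using P(1) assms(2) by (simp add: U tau_nbhd_def eventually_ball_finite_distrib)
  qed
qed

text \<open>The functionals involve only inverses, so testing against Dirac measures yields eventual
  equality of the inverses at each point, which is then carried over to the maps.\<close>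

lemma limitin_tau''_iff_pointwise:
  assumes "standard_borel_space M" "\<And>n. T n \<in> borel_aut M" "S \<in> borel_aut M"
  shows "limitin (tau''_topology M) T S sequentially \<longleftrightarrow>
    (\<forall>x\<in>space M. \<forall>\<^sub>F n in sequentially. T n x = S x)" (is "_ \<longleftrightarrow> ?pw")
proof -
  have ne: "borel_unit_ball M \<noteq> {}" by (auto simp: borel_unit_ball_def intro!: exI[of _ "\<lambda>_. 0"])
  \<comment> \<open>A supremum of reals can be compared with its terms only when the set is bounded
    above; the uniform estimate by \<open>diff_set\<close> supplies the bound.\<close>
  have bdd: "bdd_above ((\<lambda>f. \<bar>comp_functional M \<mu> A f - comp_functional M \<mu> B f\<bar>) ` borel_unit_ball M)"
    if "A \<in> borel_aut M" "B \<in> borel_aut M" "\<mu> \<in> borel_probs M" for A B \<mu>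
    using abs_comp_functional_diff_le[OF assms(1) that] by (meson bdd_aboveI2)
  show ?thesis
  proof
    assume lim: "limitin (tau''_topology M) T S sequentially"
    have "\<forall>x\<in>space M. \<forall>\<^sub>F n in sequentially. inv_into (space M) (T n) x = inv_into (space M) S x"
    proof
      fix x assume x: "x \<in> space M"
      have "tau''_nbhd M S {return M x} 1 \<in> {tau''_nbhd M T P \<epsilon> | T P \<epsilon>.
          T \<in> borel_aut M \<and> finite P \<and> P \<subseteq> borel_probs M \<and> \<epsilon> > 0}"
        using x assms(3) dirac_in_borel_probs
        by (intro CollectI exI[of _ S] exI[of _ "{return M x}"] exI[of _ 1]) auto
      moreover have "S \<in> tau''_nbhd M S {return M x} 1"
        using assms(3) ne by (simp add: tau''_nbhd_def)
      ultimately have "\<forall>\<^sub>F n in sequentially. T n \<in> tau''_nbhd M S {return M x} 1"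
        using lim unfolding tau''_topology_def limitin_topology_generated_by by meson
      then show "\<forall>\<^sub>F n in sequentially. inv_into (space M) (T n) x = inv_into (space M) S x"
      proof eventually_elim
        case (elim n)
        \<comment> \<open>This test function is 1 at the \<open>S\<close>-preimage of
          \<open>x\<close> and 0 elsewhere, so a difference of values below 1 forces the two
          preimages of \<open>x\<close> to coincide.\<close>
        define f :: "'a \<Rightarrow> real" where "f = indicator {inv_into (space M) S x}"
        have f: "f \<in> borel_measurable M"
          unfolding f_def using standard_borel_space_singleton[OF assms(1)] borel_autD(4)[OF assms(3) x]
          by simp
        then have fB: "f \<in> borel_unit_ball M"
          by (auto simp: borel_unit_ball_def f_def indicator_def)
        have dirac: "comp_functional M (return M x) R f = f (inv_into (space M) R x)"
          if "R \<in> borel_aut M" for R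
          unfolding comp_functional_def
          using x measurable_compose[OF borel_aut_inv_measurable[OF that] f]
          by (intro integral_return)
        have "\<bar>f (inv_into (space M) (T n) x) - f (inv_into (space M) S x)\<bar> \<le>
            (SUP f\<in>borel_unit_ball M. \<bar>comp_functional M (return M x) (T n) f -
              comp_functional M (return M x) S f\<bar>)"
          using cSUP_upper[OF fB bdd[OF assms(2,3) dirac_in_borel_probs[OF x]]] assms(2,3)
          by (simp add: dirac)
        also have "\<dots> < 1" using elim by (simp add: tau''_nbhd_def)
        finally show ?case by (auto simp: f_def indicator_def split: if_splits)
      qed
    qed
    then show ?pw using borel_aut_eventually_inv_eq[of T M S, OF assms(2,3)] by simp
  next
    assume pw: ?pw
    show "limitin (tau''_topology M) T S sequentially"
      unfolding tau''_topology_def limitin_topology_generated_by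
    proof (intro conjI ballI impI)
      have "S \<in> tau''_nbhd M S {} 1" using assms(3) by (simp add: tau''_nbhd_def)
      then show "S \<in> \<Union>{tau''_nbhd M T P \<epsilon> | T P \<epsilon>.
          T \<in> borel_aut M \<and> finite P \<and> P \<subseteq> borel_probs M \<and> \<epsilon> > 0}"
          using assms(3) by (intro UnionI[of "tau''_nbhd M S {} 1"] CollectI exI[of _ S]
          exI[of _ "{}"] exI[of _ 1]) auto
      fix U assume "U \<in> {tau''_nbhd M T P \<epsilon> | T P \<epsilon>.
          T \<in> borel_aut M \<and> finite P \<and> P \<subseteq> borel_probs M \<and> \<epsilon> > 0}" and SU: "S \<in> U"
      then obtain R P \<epsilon> where U: "U = tau''_nbhd M R P \<epsilon>"
        and R: "R \<in> borel_aut M" and P: "finite P" "P \<subseteq> borel_probs M" by blast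
      let ?d = "\<lambda>\<mu> A. SUP f\<in>borel_unit_ball M. \<bar>comp_functional M \<mu> A f - comp_functional M \<mu> R f\<bar>"
      have "\<forall>\<^sub>F n in sequentially. ?d \<mu> (T n) < \<epsilon>" if \<mu>: "\<mu> \<in> P" for \<mu>
      proof -
        have \<mu>': "\<mu> \<in> borel_probs M" using P \<mu> by blast
        have "?d \<mu> S < \<epsilon>" using SU U \<mu> by (simp add: tau''_nbhd_def)
        \<comment> \<open>Halving the slack absorbs the factor 2 in the estimate for the
          functionals.\<close>
        then have "\<forall>\<^sub>F n in sequentially. measure \<mu> (diff_set M (T n) S) < (\<epsilon> - ?d \<mu> S) / 2"
          by (intro order_tendstoD[OF measure_diff_set_tendsto_0] assms \<mu>' pw) simp
        then show ?thesis
        proof eventually_elim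
          case (elim n)
          have "?d \<mu> (T n) \<le> 2 * measure \<mu> (diff_set M (T n) S) + ?d \<mu> S"
          proof (rule cSUP_least[OF ne])
            fix f assume f: "f \<in> borel_unit_ball M"
            show "\<bar>comp_functional M \<mu> (T n) f - comp_functional M \<mu> R f\<bar> \<le>
                2 * measure \<mu> (diff_set M (T n) S) + ?d \<mu> S"
              using abs_comp_functional_diff_le[OF assms \<mu>' f, of n]
                cSUP_upper[OF f bdd[OF assms(3) R \<mu>']] by linarith
          qed
          then show ?case using elim by simp
        qed
      qed
      then show "\<forall>\<^sub>F n in sequentially. T n \<in> U"
        using P(1) assms(2) by (simp add: U tau''_nbhd_def eventually_ball_finite_distrib)
    qed
  qed
qed

lemma limitin_pbar_iff_pointwise:
  assumes "standard_borel_space M" "\<And>n. T n \<in> borel_aut M" "S \<in> borel_aut M"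
  shows "limitin (pbar_topology M) T S sequentially \<longleftrightarrow>
    (\<forall>x\<in>space M. \<forall>\<^sub>F n in sequentially. T n x = S x)" (is "_ \<longleftrightarrow> ?pw")
proof
  assume lim: "limitin (pbar_topology M) T S sequentially"
  show ?pw
  proof
    fix x assume x: "x \<in> space M"
    have Sx: "S x \<in> space M" and x_sets: "{x} \<in> sets M"
      using borel_autD[OF assms(3)] standard_borel_space_singleton[OF assms(1)] x by auto
    \<comment> \<open>The mass sits at \<open>S x\<close> because the symmetric difference of the
      image singletons contains \<open>S x\<close> exactly when \<open>T n x\<close> differs from
      \<open>S x\<close>.\<close>
    let ?\<mu> = "return M (S x)"
    have "pbar_nbhd M S {{x}} {?\<mu>} 1 \<in> {pbar_nbhd M T \<F> P \<epsilon> | T \<F> P \<epsilon>. T \<in> borel_aut M \<and>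
        finite \<F> \<and> \<F> \<subseteq> sets M \<and> finite P \<and> P \<subseteq> borel_probs M \<and> \<epsilon> > 0}"
      using Sx x_sets assms(3) dirac_in_borel_probs
      by (intro CollectI exI[of _ S] exI[of _ "{{x}}"] exI[of _ "{?\<mu>}"] exI[of _ 1]) auto
    moreover have "S \<in> pbar_nbhd M S {{x}} {?\<mu>} 1"
      using assms(3) by (simp add: pbar_nbhd_def)
    ultimately have "\<forall>\<^sub>F n in sequentially. T n \<in> pbar_nbhd M S {{x}} {?\<mu>} 1"
      using lim unfolding pbar_topology_def limitin_topology_generated_by by meson
    then show "\<forall>\<^sub>F n in sequentially. T n x = S x"
    proof eventually_elim
      case (elim n)
      have "measure ?\<mu> (sym_diff (T n ` {x}) (S ` {x})) + measure ?\<mu> (sym_diff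
          (inv_into (space M) (T n) ` {x}) (inv_into (space M) S ` {x})) < 1"
        using elim unfolding pbar_nbhd_def by blast
      then have "measure ?\<mu> (sym_diff (T n ` {x}) (S ` {x})) < 1"
        by (smt (verit) measure_nonneg)
      moreover have "sym_diff (T n ` {x}) (S ` {x}) \<in> sets M"
        by (intro sets.Un sets.Diff borel_aut_image_sets(1)[OF _ x_sets] assms(2,3))
      ultimately have "S x \<notin> sym_diff (T n ` {x}) (S ` {x})"
        using measure_return[of "sym_diff (T n ` {x}) (S ` {x})" M "S x"]
        by (auto simp: indicator_def simp del: Un_iff Diff_iff)
      then show ?case by auto
    qed
  qed
next
  assume pw: ?pw
  show "limitin (pbar_topology M) T S sequentially"
    unfolding pbar_topology_def limitin_topology_generated_by
  proof (intro conjI ballI impI)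
    have "S \<in> pbar_nbhd M S {} {} 1" using assms(3) by (simp add: pbar_nbhd_def)
    then show "S \<in> \<Union>{pbar_nbhd M T \<F> P \<epsilon> | T \<F> P \<epsilon>. T \<in> borel_aut M \<and>
        finite \<F> \<and> \<F> \<subseteq> sets M \<and> finite P \<and> P \<subseteq> borel_probs M \<and> \<epsilon> > 0}"
      using assms(3) by (intro UnionI[of "pbar_nbhd M S {} {} 1"] CollectI exI[of _ S]
        exI[of _ "{}"] exI[of _ "{}"] exI[of _ 1]) auto
    fix U assume "U \<in> {pbar_nbhd M T \<F> P \<epsilon> | T \<F> P \<epsilon>. T \<in> borel_aut M \<and>
        finite \<F> \<and> \<F> \<subseteq> sets M \<and> finite P \<and> P \<subseteq> borel_probs M \<and> \<epsilon> > 0}" and SU: "S \<in> U"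
    then obtain R \<F> P \<epsilon> where U: "U = pbar_nbhd M R \<F> P \<epsilon>" and R: "R \<in> borel_aut M"
      and \<F>: "finite \<F>" "\<F> \<subseteq> sets M" and P: "finite P" "P \<subseteq> borel_probs M" by blast
    let ?inv = "inv_into (space M)"
    let ?d = "\<lambda>\<mu> F A. measure \<mu> (sym_diff (A ` F) (R ` F)) + measure \<mu> (sym_diff (?inv A ` F) (?inv R ` F))"
    have "\<forall>\<^sub>F n in sequentially. ?d \<mu> F (T n) < \<epsilon>" if F: "F \<in> \<F>" and \<mu>: "\<mu> \<in> P" for F \<mu>
    proof -
      have \<mu>': "\<mu> \<in> borel_probs M" using P \<mu> by blast
      interpret prob_space \<mu> using \<mu>' by (simp add: borel_probs_def)
      have sets: "sets \<mu> = sets M" using \<mu>' by (simp add: borel_probs_def)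
      have F': "F \<in> sets M" using F \<F> by blast
      have F_space: "F \<subseteq> space M" using F' by (rule sets.sets_into_space)
      \<comment> \<open>This is the triangle inequality through \<open>B\<close>, with the distance
        from \<open>A\<close> to \<open>B\<close> replaced by the measure of a larger set
        \<open>D\<close>. It is used with \<open>B\<close> an image under \<open>S\<close> or its
        inverse and \<open>D\<close> the disagreement set.\<close>
      have triangle: "measure \<mu> (sym_diff A C) \<le> measure \<mu> D + measure \<mu> (sym_diff B C)"
        if "B \<in> sets \<mu>" "C \<in> sets \<mu>" "D \<in> sets \<mu>" "sym_diff A B \<subseteq> D" for A B C D
      proof -
        have "measure \<mu> (sym_diff A C) \<le> measure \<mu> (D \<union> sym_diff B C)"
          using that by (intro finite_measure_mono) auto
        also have "\<dots> \<le> measure \<mu> D + measure \<mu> (sym_diff B C)"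
          using that by (intro measure_Un_le) auto
        finally show ?thesis .
      qed
      have "?d \<mu> F S < \<epsilon>" using SU U \<mu> F by (simp add: pbar_nbhd_def)
      \<comment> \<open>The slack is halved because the forward and the inverse images each
        contribute one copy of this measure.\<close>
      then have "\<forall>\<^sub>F n in sequentially. measure \<mu> (diff_set M (T n) S) < (\<epsilon> - ?d \<mu> F S) / 2"
        by (intro order_tendstoD[OF measure_diff_set_tendsto_0] assms \<mu>' pw) simp
      then show ?thesis
      proof eventually_elim
        case (elim n)
        have D: "diff_set M (T n) S \<in> sets \<mu>" using diff_set_sets[OF assms] sets by simp
        have "measure \<mu> (sym_diff (T n ` F) (R ` F)) \<le>
            measure \<mu> (diff_set M (T n) S) + measure \<mu> (sym_diff (S ` F) (R ` F))"
          using borel_aut_image_sets[OF _ F'] assms(2,3) R sets D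
          by (intro triangle sym_diff_image_subset_diff_set F_space) auto
        moreover have "measure \<mu> (sym_diff (?inv (T n) ` F) (?inv R ` F)) \<le>
            measure \<mu> (diff_set M (T n) S) + measure \<mu> (sym_diff (?inv S ` F) (?inv R ` F))"
          using borel_aut_image_sets[OF _ F'] assms(2,3) R sets D
          by (intro triangle sym_diff_image_subset_diff_set F_space) auto
        ultimately show ?case using elim by argo
      qed
    qed
    then show "\<forall>\<^sub>F n in sequentially. T n \<in> U"
      using \<F>(1) P(1) assms(2) by (simp add: U pbar_nbhd_def eventually_ball_finite_distrib)
  qed
qed

section \<open>The topology \<open>p\<close> and the conclusion\<close>

lemma limitin_p_imp_pointwise:
  assumes "standard_borel_space M" "S \<in> borel_aut M"
    and lim: "limitin (p_topology M) T S F" and x: "x \<in> space M"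
  shows "\<forall>\<^sub>F n in F. T n x = S x"
proof -
  have "p_nbhd M S {{x}} \<in> {p_nbhd M T \<F> | T \<F>. T \<in> borel_aut M \<and> finite \<F> \<and> \<F> \<subseteq> sets M}"
    using standard_borel_space_singleton[OF assms(1) x] assms(2)
    by (intro CollectI exI[of _ S] exI[of _ "{{x}}"]) auto
  moreover have "S \<in> p_nbhd M S {{x}}"
    using assms(2) by (simp add: p_nbhd_def)
  ultimately have "\<forall>\<^sub>F n in F. T n \<in> p_nbhd M S {{x}}"
    using lim unfolding p_topology_def limitin_topology_generated_by by meson
  then show ?thesis
    by eventually_elim (simp add: p_nbhd_def)
qed

theorem proposition1p14:
  fixes M :: "'a measure" and T :: "nat \<Rightarrow> 'a \<Rightarrow> 'a" and S :: "'a \<Rightarrow> 'a"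
  assumes "standard_borel_space M"
    and "\<And>n. T n \<in> borel_aut M"
    and "S \<in> borel_aut M"
  shows "(limitin (p_topology M) T S sequentially \<longrightarrow> limitin (tau_topology M) T S sequentially) \<and>
    (limitin (tau_topology M) T S sequentially \<longleftrightarrow> limitin (tau''_topology M) T S sequentially) \<and>
    (limitin (tau''_topology M) T S sequentially \<longleftrightarrow> limitin (pbar_topology M) T S sequentially)"
  \<comment> \<open>The three characterisations rewrite the other limits to one pointwise condition,
    so both equivalences become trivial.\<close>
  using limitin_p_imp_pointwise[OF assms(1,3)]
  by (auto simp: limitin_tau_iff_pointwise[OF assms] limitin_tau''_iff_pointwise[OF assms]
      limitin_pbar_iff_pointwise[OF assms])

end
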